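(* Let $\mathcal{X}$ be a Banach space with dual $\mathcal{X}^*$, let $f\colon\mathcal{X}\to\mathbb{R}\cup\{+\infty\}$ be a closed function, and let $x\in\mathcal{X}$ be a point with $f(x)$ finite. Let $S\subseteq\mathcal{X}$ be an arbitrary set and let $x^*\in S$ be a point such that, for some constants $L>0$ and $\gamma>0$, the slope error-bound $$\operatorname{dist}(u;S)\leq L\cdot|\nabla f|(u)\quad\text{for all } u\in\mathbf{B}_\gamma(x^* )$$ holds. Let $f_x\colon\mathcal{X}\to\mathbb{R}\cup\{+\infty\}$ be a closed function such that for some $\eta>0$ $$|f_x(y)-f(y)|\leq\frac{\eta}{2}\|y-x\|^2\quad\text{for all } y\in\mathcal{X}.$$ Fix a point $x^+\in\mathcal{X}$ and a dual element $v\in\mathcal{X}^*$ such that $$f_x(y)\geq f_x(x^+)+\langle v,y-x^+\rangle-\frac{\eta}{2}\|y-x^+\|^2\quad\text{for all } y\in\mathcal{X}.$$ Then the following approximate step-size error-bound holds: $$\operatorname{dist}(x;S)\leq L\|v\|+(4\eta L+2)\|x^+-x\|\quad\text{whenever } x,x^+\in\mathbf{B}_{\gamma/3}(x^* ).$$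
   Context: A function is called closed if it is lower-semicontinuous. $\langle v,x\rangle:=v(x)$ for $v\in\mathcal{X}^*$, and $\|v\|$ is the dual norm. $\mathbf{B}_r(x)$ is the open ball of radius $r$ around $x$ and $\operatorname{dist}(x;S)=\inf_{y\in S}\|x-y\|$. The slope of $f$ at a point $\bar x$ with $f(\bar x)$ finite is $|\nabla f|(\bar x):=\limsup_{x\to\bar x,\,x\ne\bar x}\frac{(f(\bar x)-f(x))^+}{\|\bar x-x\|}$, where $r^+=\max\{0,r\}$ (it is $0$ if $\bar x$ is isolated); by convention $|\nabla f|(\bar x)=+\infty$ where $f(\bar x)=+\infty$. The inequality $|f_x(y)-f(y)|\le\frac{\eta}{2}\|y-x\|^2$ is understood to mean that $f_x(y)$ and $f(y)$ are either both $+\infty$ or both finite and satisfying the inequality. *)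

theory Defs
  imports "HOL-Analysis.Analysis"
begin

text \<open>Functions into \<open>\<real> \<union> {+\<infinity>}\<close> are rendered as \<^typ>\<open>ereal\<close>-valued functions
  that never take the value \<open>-\<infinity>\<close>.\<close>

definition never_minus_inf :: "('a \<Rightarrow> ereal) \<Rightarrow> bool" where
  "never_minus_inf f \<longleftrightarrow> (\<forall>y. f y \<noteq> -\<infinity>)"

definition closed_fun :: "('a::topological_space \<Rightarrow> ereal) \<Rightarrow> bool" where
  "closed_fun f \<longleftrightarrow> (\<forall>x. f x \<le> Liminf (at x) f)"

text \<open>The filter \<^term>\<open>at x\<close> excludes \<open>x\<close> itself. The isolated case is separate because
  the \<open>Limsup\<close> of an \<^typ>\<open>ereal\<close>-valued function along the trivial filter is \<open>-\<infinity>\<close>, not \<open>0\<close>.\<close>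

definition slope :: "('a::real_normed_vector \<Rightarrow> ereal) \<Rightarrow> 'a \<Rightarrow> ereal" where
  "slope f x =
     (if f x = \<infinity> then \<infinity>
      else if at x = bot then 0
      else Limsup (at x) (\<lambda>y. max 0 (f x - f y) / ereal (norm (x - y))))"

text \<open>\<open>\<bar>a - b\<bar> \<le> c\<close> for \<open>a, b \<in> \<real> \<union> {+\<infinity>}\<close>, read as: both are \<open>+\<infinity>\<close>, or both are finite
  and satisfy the inequality.\<close>

definition ext_abs_diff_le :: "ereal \<Rightarrow> ereal \<Rightarrow> real \<Rightarrow> bool" where
  "ext_abs_diff_le a b c \<longleftrightarrow>
     (a = \<infinity> \<and> b = \<infinity>) \<or> (\<bar>a\<bar> \<noteq> \<infinity> \<and> \<bar>b\<bar> \<noteq> \<infinity> \<and> \<bar>a - b\<bar> \<le> ereal c)"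

end

theory Submission
  imports Defs
begin

text \<open>The function \<open>g(y) = f(y) - \<langle>v, y - x\<^sup>+\<rangle> + \<eta>/2 \<parallel>y - x\<parallel>\<^sup>2 + \<eta>/2 \<parallel>y - x\<^sup>+\<parallel>\<^sup>2\<close> is bounded below by
  \<open>f\<^sub>x(x\<^sup>+)\<close>, while \<open>g(x\<^sup>+) \<le> f\<^sub>x(x\<^sup>+) + \<eta>r\<^sup>2\<close> for \<open>r = \<parallel>x\<^sup>+ - x\<parallel>\<close>. Ekeland's variational principle
  yields a point \<open>u\<close> within \<open>r\<close> of \<open>x\<^sup>+\<close> that minimizes \<open>g + \<eta>r \<parallel>\<cdot> - u\<parallel>\<close>. The slope of \<open>f\<close> at \<open>u\<close>
  is then at most \<open>\<parallel>v\<parallel> + \<eta>\<parallel>u - x\<parallel> + \<eta>\<parallel>u - x\<^sup>+\<parallel> + \<eta>r \<le> \<parallel>v\<parallel> + 4\<eta>r\<close>; the error bound at \<open>u\<close> and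
  \<open>dist(x; S) \<le> \<parallel>x - u\<parallel> + dist(u; S)\<close> finish the proof.\<close>

section \<open>Lower semicontinuity: sublevel sets and continuous perturbations\<close>

lemma closed_fun_iff_eventually:
  "closed_fun f \<longleftrightarrow> (\<forall>x z. z < f x \<longrightarrow> (\<forall>\<^sub>F y in nhds x. z < f y))"
  by (auto simp: closed_fun_def le_Liminf_iff eventually_nhds_conv_at)

lemma closed_sublevel_closed_fun:
  assumes "closed_fun f"
  shows "closed {y. f y \<le> k}"
proof -
  have "open {y. k < f y}"
    using assms unfolding closed_fun_iff_eventually eventually_nhds
    by (subst open_subopen) (metis mem_Collect_eq subsetI)
  moreover have "- {y. f y \<le> k} = {y. k < f y}"
    by auto
  ultimately show ?thesis
    by (simp add: closed_def)
qed

lemma closed_fun_add_continuous: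
  fixes h :: "'a::topological_space \<Rightarrow> real"
  assumes f: "closed_fun f" and h: "continuous_on UNIV h"
  shows "closed_fun (\<lambda>y. f y + ereal (h y))"
  unfolding closed_fun_iff_eventually
proof (intro allI impI)
  fix x z
  assume z: "z < f x + ereal (h x)"
  then have "z - ereal (h x) < f x"
    by (cases "f x"; cases z) auto
  \<comment> \<open>The real \<open>w\<close> splits the gap: near \<open>x\<close>,
    \<open>w < f y\<close> and, for a real \<open>z = s\<close>, \<open>s - w < h y\<close>, and
    these add up to \<open>z < f y + h y\<close>. For \<open>z = -\<infinity>\<close>,
    \<open>w < f y\<close> already excludes the value \<open>-\<infinity>\<close>.\<close>
  then obtain w where w: "z - ereal (h x) < ereal w" "ereal w < f x"
    using ereal_dense2 by blast
  have f_ev: "\<forall>\<^sub>F y in nhds x. ereal w < f y"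
    using f w(2) by (simp add: closed_fun_iff_eventually)
  show "\<forall>\<^sub>F y in nhds x. z < f y + ereal (h y)"
  proof (cases z)
    case (real s)
    have "(h \<longlongrightarrow> h x) (nhds x)"
      using h by (simp add: continuous_on_def flip: tendsto_at_iff_tendsto_nhds)
    moreover have "s - w < h x"
      using w(1) real by simp
    ultimately have "\<forall>\<^sub>F y in nhds x. s - w < h y"
      by (rule order_tendstoD)
    with f_ev show ?thesis
    proof eventually_elim
      case (elim y)
      then show ?case
        using real by (cases "f y") auto
    qed
  next
    case PInf
    then show ?thesis using z by simp
  next
    case MInf
    show ?thesis
      using f_ev
    proof eventually_elim
      case (elim y)
      then show ?case
        using MInf by (cases "f y") auto
    qed
  qed
qed

section \<open>Ekeland's variational principle in complete metric spaces\<close>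

theorem ekeland_variational_principle:
  fixes F :: "'a::complete_space \<Rightarrow> ereal"
  assumes lsc: "closed_fun F" and lower: "\<And>y. ereal m \<le> F y"
    and x0: "F x0 \<noteq> \<infinity>" and c: "c > 0"
  obtains u where "F u + ereal (c * dist u x0) \<le> F x0"
    and "\<And>y. y \<noteq> u \<Longrightarrow> F u < F y + ereal (c * dist y u)"
proof -
  \<comment> \<open>\<open>T x\<close> is the set of points below \<open>x\<close> in Ekeland's
    preorder; transitivity is the triangle inequality. The strict inequality sought says that
    \<open>T u\<close> contains no point other than \<open>u\<close>.\<close>
  define T where "T x = {y. F y + ereal (c * dist y x) \<le> F x}" for x
  have closed_T: "closed (T x)" for x
    unfolding T_def
    by (intro closed_sublevel_closed_fun closed_fun_add_continuous lsc continuous_intros)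
  have refl: "x \<in> T x" for x
    by (simp add: T_def)
  have T_le: "F y \<le> F x" if "y \<in> T x" for x y
  proof -
    have "F y + 0 \<le> F y + ereal (c * dist y x)"
      using c by (intro add_left_mono) simp
    then show ?thesis
      using that by (simp add: T_def)
  qed
  have trans: "T y \<subseteq> T x" if y: "y \<in> T x" for x y
  proof
    fix w
    assume w: "w \<in> T y"
    have "c * dist w x \<le> c * dist w y + c * dist y x"
      using c dist_triangle[of w x y] by (simp flip: distrib_left)
    then have "F w + ereal (c * dist w x) \<le> F w + ereal (c * dist w y) + ereal (c * dist y x)"
      by (simp add: add.assoc add_left_mono)
    also have "\<dots> \<le> F y + ereal (c * dist y x)"
      using w by (simp add: T_def add_right_mono)
    also have "\<dots> \<le> F x"
      using y by (simp add: T_def)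
    finally show "w \<in> T x"
      by (simp add: T_def)
  qed
  have step: "\<exists>y. (y \<in> T x \<and> F y \<noteq> \<infinity>) \<and> (\<forall>w\<in>T x. F y \<le> F w + ereal ((1/2)^n))"
    if fin: "F x \<noteq> \<infinity>" for x and n :: nat
  proof -
    let ?I = "INF w\<in>T x. F w"
    have "ereal m \<le> ?I"
      by (intro INF_greatest lower)
    moreover have "?I \<le> F x"
      by (intro INF_lower refl)
    \<comment> \<open>The infimum is finite, lying between \<open>m\<close> and \<open>F x\<close>,
      so adding \<open>(1/2)^n\<close> strictly raises it and a near-minimizer exists.\<close>
    ultimately have "?I < ?I + ereal ((1/2)^n)"
      using fin by (cases ?I) auto
    then obtain y where y: "y \<in> T x" "F y < ?I + ereal ((1/2)^n)"
      by (auto simp: INF_less_iff)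
    have "F y \<le> F w + ereal ((1/2)^n)" if "w \<in> T x" for w
      using y(2) INF_lower[OF that, of F] by (meson add_right_mono less_imp_le order_trans)
    moreover have "F y \<noteq> \<infinity>"
      using T_le[OF y(1)] fin by auto
    ultimately show ?thesis
      using y(1) by blast
  qed
  obtain X where X0: "X 0 = x0" and X_fin: "\<And>n. F (X n) \<noteq> \<infinity>"
    and X_T: "\<And>n. X (Suc n) \<in> T (X n)"
    and X_inf: "\<And>n w. w \<in> T (X n) \<Longrightarrow> F (X (Suc n)) \<le> F w + ereal ((1/2)^n)"
  proof -
    have "\<exists>X. \<forall>n. (F (X n) \<noteq> \<infinity> \<and> (n = 0 \<longrightarrow> X n = x0)) \<and>
        (X (Suc n) \<in> T (X n) \<and> (\<forall>w\<in>T (X n). F (X (Suc n)) \<le> F w + ereal ((1/2)^n)))"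
      by (rule dependent_nat_choice) (use x0 step in blast)+
    then show thesis
      using that by blast
  qed
  \<comment> \<open>Membership in \<open>T (X (Suc n))\<close> requires a decrease of
    \<open>F\<close> by at least \<open>c\<close> times the distance. As \<open>X (Suc n)\<close> is
    minimal up to \<open>(1/2)^n\<close> over the larger set \<open>T (X n)\<close>, little decrease
    is left.\<close>
  have small: "dist w (X (Suc n)) \<le> (1/2)^n / c" if w: "w \<in> T (X (Suc n))" for w n
  proof -
    have "F w + ereal (c * dist w (X (Suc n))) \<le> F w + ereal ((1/2)^n)"
      using w X_inf[of w n] trans[OF X_T[of n]] unfolding T_def
      by (metis (mono_tags, lifting) mem_Collect_eq order_trans subsetD)
    moreover have "\<bar>F w\<bar> \<noteq> \<infinity>"
      using lower[of w] T_le[OF w] X_fin[of "Suc n"] by auto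
    ultimately have "c * dist w (X (Suc n)) \<le> (1/2)^n"
      by (cases "F w") auto
    then show ?thesis
      using c by (simp add: field_simps)
  qed
  have null: "(\<lambda>n. (1/2)^n / c) \<longlonglongrightarrow> 0"
    by (intro tendsto_divide_zero LIMSEQ_power_zero) simp
  \<comment> \<open>Cantor's intersection theorem: the sets \<open>T (X n)\<close> are closed,
    nonempty and nested, with diameters tending to 0.\<close>
  obtain u where u: "\<And>n. u \<in> T (X n)"
  proof (rule decreasing_closed_nest[of "\<lambda>n. T (X n)"])
    show "T (X n) \<noteq> {}" for n
      using refl by blast
    show "T (X n) \<subseteq> T (X k)" if "k \<le> n" for k n
      using that by (rule lift_Suc_antimono_le[of "\<lambda>n. T (X n)", rotated]) (rule trans[OF X_T])
    show "\<exists>n. \<forall>y\<in>T (X n). \<forall>w\<in>T (X n). dist y w < e" if "e > 0" for e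
    proof -
      have "\<forall>\<^sub>F n in sequentially. (1/2)^n / c < e / 2"
        using that by (intro order_tendstoD(2)[OF null]) simp
      then obtain n where n: "(1/2)^n / c < e / 2"
        by (auto simp: eventually_sequentially)
      have "dist y w < e" if "y \<in> T (X (Suc n))" "w \<in> T (X (Suc n))" for y w
        using small[OF that(1)] small[OF that(2)] n dist_triangle2[of y w "X (Suc n)"] by linarith
      then show ?thesis
        by blast
    qed
  qed (use closed_T in blast)+
  have "F u < F y + ereal (c * dist y u)" if "y \<noteq> u" for y
  \<comment> \<open>A violating \<open>y\<close> lies in \<open>T u\<close>, hence in every
    \<open>T (X n)\<close> along with \<open>u\<close>; the shrinking diameters force
    \<open>y = u\<close>.\<close>
  proof (rule ccontr)
    assume "\<not> ?thesis"
    then have "y \<in> T u"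
      by (simp add: T_def not_less)
    then have y: "y \<in> T (X n)" for n
      using trans[OF u, of n] by blast
    have "dist y u \<le> (1/2)^n / c + (1/2)^n / c" for n
      using small[OF y, of n] small[OF u, of n] dist_triangle2[of y u "X (Suc n)"] by linarith
    moreover have "(\<lambda>n. (1/2)^n / c + (1/2)^n / c) \<longlonglongrightarrow> 0"
      using tendsto_add[OF null null] by simp
    ultimately have "dist y u \<le> 0"
      by (meson LIMSEQ_le_const)
    then show False
      using that by simp
  qed
  moreover have "F u + ereal (c * dist u x0) \<le> F x0"
    using u[of 0] by (simp add: T_def X0)
  ultimately show thesis
    using that by blast
qed

section \<open>Bounding the slope by a local first-order estimate\<close>

lemma slope_le:
  assumes fin: "\<bar>f u\<bar> \<noteq> \<infinity>" and C: "C \<ge> 0"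
    and bound: "\<And>y. y \<noteq> u \<Longrightarrow> f u \<le> f y + ereal ((C + K * norm (u - y)) * norm (u - y))"
    and K: "K \<ge> 0"
  shows "slope f u \<le> ereal C"
proof (cases "at u = bot")
  case True
  then show ?thesis
    using fin C by (auto simp: slope_def)
next
  case False
  have "max 0 (f u - f y) / ereal (norm (u - y)) \<le> ereal (C + K * norm (u - y))"
    if "y \<noteq> u" for y
  proof -
    have pos: "norm (u - y) > 0" and nn: "0 \<le> C + K * norm (u - y)"
      using that C K by auto
    have "f u - f y \<le> ereal ((C + K * norm (u - y)) * norm (u - y))"
      using bound[OF that] fin by (cases "f u"; cases "f y") auto
    then have "max 0 (f u - f y) \<le> ereal ((C + K * norm (u - y)) * norm (u - y))"
      using pos nn by simp
    then show ?thesis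
      using pos by (simp add: ereal_divide_le_pos mult.commute)
  qed
  \<comment> \<open>The quadratic error leaves only \<open>K * norm (u - y)\<close> in the quotient,
    which vanishes as \<open>y\<close> tends to \<open>u\<close>.\<close>
  then have "Limsup (at u) (\<lambda>y. max 0 (f u - f y) / ereal (norm (u - y)))
      \<le> Limsup (at u) (\<lambda>y. ereal (C + K * norm (u - y)))"
    by (intro Limsup_mono) (auto simp: eventually_at_filter)
  also have "\<dots> = ereal C"
  proof (rule lim_imp_Limsup[OF False])
    have "((\<lambda>y. C + K * norm (u - y)) \<longlongrightarrow> C + K * norm (u - u)) (at u)"
      by (intro tendsto_intros)
    then show "((\<lambda>y. ereal (C + K * norm (u - y))) \<longlongrightarrow> ereal C) (at u)"
      by simp
  qed
  finally show ?thesis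
    using fin False by (auto simp: slope_def)
qed

text \<open>Squaring the triangle inequality gives it. The factor splits into a first-order part
  \<open>2 * norm (u - x)\<close> and a remainder that \<open>slope_le\<close> absorbs into
  \<open>K\<close>.\<close>

lemma norm_sq_diff_le:
  fixes u y x :: "'a::real_normed_vector"
  shows "(norm (y - x))\<^sup>2 - (norm (u - x))\<^sup>2 \<le> (2 * norm (u - x) + norm (u - y)) * norm (u - y)"
proof -
  have "norm (y - x) \<le> norm (u - x) + norm (u - y)"
    using norm_triangle_ineq[of "y - u" "u - x"] by (simp add: norm_minus_commute)
  then have "(norm (y - x))\<^sup>2 \<le> (norm (u - x) + norm (u - y))\<^sup>2"
    by (intro power_mono) auto
  then show ?thesis
    by (simp add: power2_eq_square algebra_simps)
qed

section \<open>The step-size error bound\<close>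

theorem corollary5p11:
  fixes f f\<^sub>x :: "'a::banach \<Rightarrow> ereal"
    and x x_star x_plus :: 'a
    and S :: "'a set"
    and v :: "'a \<Rightarrow>\<^sub>L real"
    and L \<gamma> \<eta> :: real
  assumes "never_minus_inf f" and "closed_fun f" and "\<bar>f x\<bar> \<noteq> \<infinity>"
    and "x_star \<in> S" and "L > 0" and "\<gamma> > 0"
    and "\<forall>u\<in>ball x_star \<gamma>. ereal (infdist u S) \<le> ereal L * slope f u"
    and "never_minus_inf f\<^sub>x" and "closed_fun f\<^sub>x" and "\<eta> > 0"
    and "\<forall>y. ext_abs_diff_le (f\<^sub>x y) (f y) (\<eta> / 2 * (norm (y - x))\<^sup>2)"
    and "\<forall>y. f\<^sub>x y \<ge> f\<^sub>x x_plus + ereal (blinfun_apply v (y - x_plus))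
                     - ereal (\<eta> / 2 * (norm (y - x_plus))\<^sup>2)"
    and "x \<in> ball x_star (\<gamma> / 3)" and "x_plus \<in> ball x_star (\<gamma> / 3)"
  shows "infdist x S \<le> L * norm v + (4 * \<eta> * L + 2) * norm (x_plus - x)"
proof -
  define r where "r = norm (x_plus - x)"
  define h where "h y = \<eta> / 2 * (norm (y - x))\<^sup>2 + \<eta> / 2 * (norm (y - x_plus))\<^sup>2
      - blinfun_apply v (y - x_plus)" for y
  define g where "g y = f y + ereal (h y)" for y
  have model: "ext_abs_diff_le (f\<^sub>x y) (f y) (\<eta> / 2 * (norm (y - x))\<^sup>2)" for y
    using assms(11) by blast
  have prox: "f\<^sub>x x_plus + ereal (blinfun_apply v (y - x_plus))
      - ereal (\<eta> / 2 * (norm (y - x_plus))\<^sup>2) \<le> f\<^sub>x y" for y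
    using assms(12) by blast
  have "\<bar>f\<^sub>x x\<bar> \<noteq> \<infinity>"
    using model[of x] assms(3) by (auto simp: ext_abs_diff_le_def)
  then have "f\<^sub>x x_plus \<noteq> \<infinity>"
    using prox[of x] by auto
  then obtain m p where m: "f\<^sub>x x_plus = ereal m" and p: "f x_plus = ereal p"
      and mp: "\<bar>m - p\<bar> \<le> \<eta> / 2 * r\<^sup>2"
    using model[of x_plus] unfolding r_def ext_abs_diff_le_def
    by (cases "f\<^sub>x x_plus"; cases "f x_plus") auto
  \<comment> \<open>The first quadratic in \<open>h\<close> pays for replacing
    \<open>f\<^sub>x\<close> by \<open>f\<close>; the second cancels the loss in
    \<open>prox\<close>.\<close>
  have lower: "ereal m \<le> g y" for y
    using model[of y] prox[of y] m unfolding g_def h_def ext_abs_diff_le_def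
    by (cases "f\<^sub>x y"; cases "f y") (auto simp: abs_if field_simps split: if_splits)
  have g_plus: "g x_plus = ereal (p + \<eta> / 2 * r\<^sup>2)"
    by (simp add: g_def h_def p r_def)
  \<comment> \<open>The model error at \<open>x_plus\<close> and \<open>h x_plus\<close> contribute
    \<open>\<eta> / 2 * r\<^sup>2\<close> each. With Ekeland constant \<open>\<eta> * r\<close>,
    this gap gives the radius \<open>r\<close>.\<close>
  have near_min: "p + \<eta> / 2 * r\<^sup>2 \<le> m + \<eta> * r\<^sup>2"
    using mp by linarith
  have "\<exists>u. g u \<noteq> \<infinity> \<and> dist u x_plus \<le> r \<and> (\<forall>y. g u \<le> g y + ereal (\<eta> * r * dist y u))"
  proof (cases "r = 0")
    \<comment> \<open>Ekeland's constant \<open>\<eta> * r\<close> must be positive. For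
      \<open>r = 0\<close> the gap vanishes and \<open>x_plus\<close> itself minimizes
      \<open>g\<close>.\<close>
    case True
    then have "g x_plus \<le> g y" for y
      using lower[of y] g_plus near_min by (auto intro: order_trans[rotated])
    then show ?thesis
      using True g_plus by (intro exI[of _ x_plus]) auto
  next
    case False
    then have r: "r > 0"
      by (simp add: r_def)
    have "closed_fun g"
      unfolding g_def h_def
      by (intro closed_fun_add_continuous assms continuous_intros)
    moreover have "g x_plus \<noteq> \<infinity>" "\<eta> * r > 0"
      using g_plus r assms(10) by auto
    ultimately obtain u where u: "g u + ereal (\<eta> * r * dist u x_plus) \<le> g x_plus"
      and min: "\<And>y. y \<noteq> u \<Longrightarrow> g u < g y + ereal (\<eta> * r * dist y u)"
      using ekeland_variational_principle[of g m x_plus "\<eta> * r"] lower by metis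
    have "g u \<noteq> \<infinity>"
      using u g_plus by auto
    moreover have "\<eta> * r * dist u x_plus \<le> \<eta> * r * r"
      using u lower[of u] g_plus near_min
      by (cases "g u") (auto simp: power2_eq_square mult.assoc)
    then have "dist u x_plus \<le> r"
      using \<open>\<eta> * r > 0\<close> by (simp only: mult_le_cancel_left_pos)
    moreover have "g u \<le> g y + ereal (\<eta> * r * dist y u)" for y
      using min[of y] by (cases "y = u") auto
    ultimately show ?thesis
      by blast
  qed
  then obtain u where u_fin: "g u \<noteq> \<infinity>" and u_dist: "dist u x_plus \<le> r"
    and u_min: "\<And>y. g u \<le> g y + ereal (\<eta> * r * dist y u)"
    by blast
  have u_plus: "norm (u - x_plus) \<le> r"
    using u_dist by (simp add: dist_norm)
  have u_x: "norm (u - x) \<le> 2 * r"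
    using norm_triangle_ineq[of "u - x_plus" "x_plus - x"] u_plus by (simp add: r_def)
  have "slope f u \<le> ereal (norm v + 4 * \<eta> * r)"
  proof (rule slope_le[where K = \<eta>])
    show "\<bar>f u\<bar> \<noteq> \<infinity>"
      using u_fin assms(1) by (auto simp: g_def never_minus_inf_def)
    show "0 \<le> norm v + 4 * \<eta> * r" "0 \<le> \<eta>"
      using assms(10) by (simp_all add: r_def)
    fix y
    let ?d = "norm (u - y)"
    have "\<eta> / 2 * ((norm (y - x))\<^sup>2 - (norm (u - x))\<^sup>2) \<le> \<eta> / 2 * ((4 * r + ?d) * ?d)"
      using norm_sq_diff_le[of y x u] u_x assms(10)
      by (intro mult_left_mono order_trans[OF norm_sq_diff_le] mult_right_mono) auto
    moreover have "\<eta> / 2 * ((norm (y - x_plus))\<^sup>2 - (norm (u - x_plus))\<^sup>2)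
        \<le> \<eta> / 2 * ((2 * r + ?d) * ?d)"
      using u_plus assms(10)
      by (intro mult_left_mono order_trans[OF norm_sq_diff_le] mult_right_mono) auto
    moreover have "blinfun_apply v (u - x_plus) - blinfun_apply v (y - x_plus) \<le> norm v * ?d"
      using norm_blinfun[of v "u - y"] by (simp add: blinfun.diff_right)
    \<comment> \<open>The first-order terms in \<open>r\<close> sum to
      \<open>2 * \<eta> * r + \<eta> * r + \<eta> * r\<close>; the two remainders
      \<open>\<eta> / 2 * ?d\<close> give \<open>K = \<eta>\<close>.\<close>
    ultimately have "h y - h u + \<eta> * r * dist y u \<le> (norm v + 4 * \<eta> * r + \<eta> * ?d) * ?d"
      by (simp add: h_def dist_norm norm_minus_commute[of y u] field_simps)
    moreover have "f u \<le> f y + ereal (h y - h u + \<eta> * r * dist y u)"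
      using u_min[of y] unfolding g_def by (cases "f u"; cases "f y") auto
    ultimately show "f u \<le> f y + ereal ((norm v + 4 * \<eta> * r + \<eta> * ?d) * ?d)"
      by (meson add_left_mono ereal_less_eq(3) order_trans)
  qed
  then have "ereal L * slope f u \<le> ereal (L * (norm v + 4 * \<eta> * r))"
    using assms(5) ereal_mult_left_mono[of "slope f u" _ "ereal L"] by fastforce
  \<comment> \<open>Here the radius \<open>\<gamma> / 3\<close> enters: \<open>u\<close> is within
    \<open>r < 2 * \<gamma> / 3\<close> of \<open>x_plus\<close>, which is within
    \<open>\<gamma> / 3\<close> of \<open>x_star\<close>.\<close>
  moreover have "u \<in> ball x_star \<gamma>"
  proof -
    have "r < 2 * \<gamma> / 3"
      using assms(13,14) dist_triangle3[of x_plus x x_star] by (simp add: r_def dist_norm)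
    then show ?thesis
      using assms(14) u_dist dist_triangle2[of x_star u x_plus] by simp
  qed
  ultimately have "ereal (infdist u S) \<le> ereal (L * (norm v + 4 * \<eta> * r))"
    using assms(7) order_trans by blast
  moreover have "infdist x S \<le> infdist u S + norm (u - x)"
    using infdist_triangle[of x S u] by (simp add: dist_norm norm_minus_commute)
  ultimately have "infdist x S \<le> L * (norm v + 4 * \<eta> * r) + 2 * r"
    using u_x by simp
  then show ?thesis
    by (simp add: r_def algebra_simps)
qed

end
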